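(* Let $X$ be a partially ordered vector space that contains net catching elements, with order topology $\tau_o$ and order bound topology $\tau_{ob}$. Then the following statements are equivalent. (i) $\tau_o$ is a linear topology. (ii) $\tau_o=\tau_{ob}$. (iii) $X$ is Archimedean and directed. In particular, if one of these statements is valid, then each net catching element $x\in X$ is an order unit of $X$ and the norm $\|\cdot\|_x$ generates $\tau_o$.
   Context: A partially ordered vector space is a real vector space $X$ with a partial order $\leq$ such that $x\leq y$ implies $x+z\leq y+z$ and $\lambda x\leq\lambda y$ for all $z\in X$ and real $\lambda\geq 0$; $X_+=\{x\in X;\ x\geq 0\}$, and order intervals are the sets $[x,y]=\{z\in X;\ x\leq z\leq y\}$. $X$ is Archimedean if for all $x,y\in X$ with $nx\leq y$ for all $n\in\mathbb{N}$ one has $x\leq 0$; $X$ is directed if any two elements have a common upper bound. An element $u\in X_+$ is an order unit if for every $x\in X$ there is $n\in\mathbb{N}$ with $x\leq nu$. For an order unit $u$ and $y\in X$, $\|y\|_u:=\inf\{\lambda>0;\ -\lambda u\leq y\leq\lambda u\}$. A linear topology is one making addition and scalar multiplication (jointly) continuous. For a net $(x_\alpha)_{\alpha\in A}$ in $X$ we write $x_\alpha\downarrow 0$ if the net is decreasing ($\alpha\leq\beta$ implies $x_\beta\leq x_\alpha$) and $\inf_{\alpha\in A} x_\alpha=0$. A set $M\subseteq X$ is net catching for $x\in X$ if for every net $(x_\alpha)_{\alpha\in A}$ in $X$ with $x_\alpha\downarrow 0$ there is $\alpha\in A$ with $[x-x_\alpha,x+x_\alpha]\subseteq M$. A set $O\subseteq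 X$ is order open if it is net catching for every $x\in O$. The order topology is $\tau_o=\{O\subseteq X;\ O\text{ order open}\}$. An element $y\in X$ is called net catching if for every net $(x_\alpha)_{\alpha\in A}$ in $X$ with $x_\alpha\downarrow 0$ there is $\alpha\in A$ with $x_\alpha\leq y$. A set $M\subseteq X$ is circled if $\lambda M\subseteq M$ for all $\lambda\in[-1,1]$; $M$ absorbs $N\subseteq X$ if there is $\mu>0$ with $\lambda N\subseteq M$ for all $\lambda\in[-\mu,\mu]$. Let $\mathcal{B}_{ob}$ be the set of all convex, circled $V\subseteq X$ that absorb all order intervals. The order bound topology $\tau_{ob}$ is the vector space topology on $X$ for which $\mathcal{B}_{ob}$ is a base of neighbourhoods at $0$. *)

theory Defs
  imports "HOL-Analysis.Analysis"
begin

text \<open>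
  A partially ordered vector space is a type of class \<^class>\<open>ordered_real_vector\<close>. The remaining
  axiom of that class, \<open>scaleR_right_mono\<close>, follows from the two compatibility axioms of the
  partial order. Topologies on the space are values of type \<open>'a topology\<close>.
\<close>

section \<open>Order-theoretic notions\<close>

definition archimedean_space :: "'a::ordered_real_vector itself \<Rightarrow> bool" where
  "archimedean_space _ \<longleftrightarrow>
     (\<forall>x y :: 'a. (\<forall>n::nat. real n *\<^sub>R x \<le> y) \<longrightarrow> x \<le> 0)"

definition directed_space :: "'a::ordered_real_vector itself \<Rightarrow> bool" where
  "directed_space _ \<longleftrightarrow> (\<forall>x y :: 'a. \<exists>z. x \<le> z \<and> y \<le> z)"

definition order_unit :: "'a::ordered_real_vector \<Rightarrow> bool" where
  "order_unit u \<longleftrightarrow> 0 \<le> u \<and> (\<forall>x. \<exists>n::nat. x \<le> real n *\<^sub>R u)"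

definition order_unit_norm :: "'a::ordered_real_vector \<Rightarrow> 'a \<Rightarrow> real" where
  "order_unit_norm u y = Inf {l. 0 < l \<and> - (l *\<^sub>R u) \<le> y \<and> y \<le> l *\<^sub>R u}"

definition is_norm :: "('a::real_vector \<Rightarrow> real) \<Rightarrow> bool" where
  "is_norm p \<longleftrightarrow>
     (\<forall>x. 0 \<le> p x) \<and> (\<forall>x. p x = 0 \<longleftrightarrow> x = 0) \<and>
     (\<forall>x y. p (x + y) \<le> p x + p y) \<and>
     (\<forall>c x. p (c *\<^sub>R x) = \<bar>c\<bar> * p x)"

definition norm_generates :: "('a::real_vector \<Rightarrow> real) \<Rightarrow> 'a topology \<Rightarrow> bool" where
  "norm_generates p T \<longleftrightarrow>
     is_norm p \<and> Metric_space.mtopology UNIV (\<lambda>x y. p (x - y)) = T"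

section \<open>Nets decreasing to zero\<close>

definition directed_index :: "'i set \<Rightarrow> 'i rel \<Rightarrow> bool" where
  "directed_index A r \<longleftrightarrow>
     A \<noteq> {} \<and> preorder_on A r \<and> (\<forall>a\<in>A. \<forall>b\<in>A. \<exists>c\<in>A. (a, c) \<in> r \<and> (b, c) \<in> r)"

definition net_decreasing_to_0 ::
    "'i set \<Rightarrow> 'i rel \<Rightarrow> ('i \<Rightarrow> 'a::ordered_real_vector) \<Rightarrow> bool" where
  "net_decreasing_to_0 A r x \<longleftrightarrow>
     directed_index A r \<and>
     (\<forall>a\<in>A. \<forall>b\<in>A. (a, b) \<in> r \<longrightarrow> x b \<le> x a) \<and>
     (\<forall>a\<in>A. 0 \<le> x a) \<and> (\<forall>z. (\<forall>a\<in>A. z \<le> x a) \<longrightarrow> z \<le> 0)"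

text \<open>
  HOL cannot quantify over the type of the index set inside a definition. The definitions below
  let the index sets range over all subsets of the space itself, with an arbitrary directed
  preorder. This loses nothing: the lemmas \<open>net_catching_for_any_index\<close> and
  \<open>net_catching_element_any_index\<close> give the same property for nets over every index type.
\<close>

definition net_catching_for :: "'a::ordered_real_vector set \<Rightarrow> 'a \<Rightarrow> bool" where
  "net_catching_for M x \<longleftrightarrow>
     (\<forall>(A :: 'a set) r f. net_decreasing_to_0 A r f \<longrightarrow>
        (\<exists>a\<in>A. {x - f a .. x + f a} \<subseteq> M))"

definition net_catching_element :: "'a::ordered_real_vector \<Rightarrow> bool" where
  "net_catching_element y \<longleftrightarrow>
     (\<forall>(A :: 'a set) r f. net_decreasing_to_0 A r f \<longrightarrow> (\<exists>a\<in>A. f a \<le> y))"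

lemma net_decreasing_to_0_range:
  fixes f :: "'i \<Rightarrow> 'a::ordered_real_vector"
  assumes "net_decreasing_to_0 A r f"
  shows "net_decreasing_to_0 (f ` A) {(s, t). s \<in> f ` A \<and> t \<in> f ` A \<and> t \<le> s} (\<lambda>s. s)"
proof -
  have 1: "directed_index A r" and 2: "\<And>a b. a \<in> A \<Longrightarrow> b \<in> A \<Longrightarrow> (a, b) \<in> r \<Longrightarrow> f b \<le> f a"
    and 3: "\<forall>a\<in>A. 0 \<le> f a" "\<forall>z. (\<forall>a\<in>A. z \<le> f a) \<longrightarrow> z \<le> 0"
    using assms unfolding net_decreasing_to_0_def by blast+
  let ?R = "{(s, t). s \<in> f ` A \<and> t \<in> f ` A \<and> t \<le> s}"
  have "preorder_on (f ` A) ?R"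
    unfolding preorder_on_def refl_on_def trans_def by (auto intro: order_trans)
  moreover have "\<exists>c\<in>f ` A. (s, c) \<in> ?R \<and> (t, c) \<in> ?R" if st: "s \<in> f ` A" "t \<in> f ` A" for s t
  proof -
    from st obtain a b where ab: "a \<in> A" "b \<in> A" "s = f a" "t = f b" by blast
    then obtain c where "c \<in> A" "(a, c) \<in> r" "(b, c) \<in> r"
      using 1 unfolding directed_index_def by blast
    with ab 2 show ?thesis by (intro bexI[of _ "f c"]) auto
  qed
  ultimately have "directed_index (f ` A) ?R"
    using 1 unfolding directed_index_def by simp
  then show ?thesis
    using 3 unfolding net_decreasing_to_0_def by auto
qed

lemma net_catching_for_any_index:
  fixes f :: "'i \<Rightarrow> 'a::ordered_real_vector"
  assumes "net_catching_for M x" "net_decreasing_to_0 A r f"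
  shows "\<exists>a\<in>A. {x - f a .. x + f a} \<subseteq> M"
proof -
  have "\<exists>s\<in>f ` A. {x - s .. x + s} \<subseteq> M"
    using assms(1)[unfolded net_catching_for_def, rule_format,
        OF net_decreasing_to_0_range[OF assms(2)]] .
  then show ?thesis by (simp only: bex_simps)
qed

lemma net_catching_element_any_index:
  fixes f :: "'i \<Rightarrow> 'a::ordered_real_vector"
  assumes "net_catching_element y" "net_decreasing_to_0 A r f"
  shows "\<exists>a\<in>A. f a \<le> y"
proof -
  have "\<exists>s\<in>f ` A. s \<le> y"
    using assms(1)[unfolded net_catching_element_def, rule_format,
        OF net_decreasing_to_0_range[OF assms(2)]] .
  then show ?thesis by (simp only: bex_simps)
qed

section \<open>The order topology\<close>

definition order_open :: "'a::ordered_real_vector set \<Rightarrow> bool" where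
  "order_open U \<longleftrightarrow> (\<forall>x\<in>U. net_catching_for U x)"

definition order_topology :: "'a::ordered_real_vector topology" where
  "order_topology = topology order_open"

lemma istopology_order_open: "istopology (order_open :: 'a::ordered_real_vector set \<Rightarrow> bool)"
  unfolding istopology_def
proof (intro conjI allI impI)
  fix S T :: "'a set"
  assume ST: "order_open S" "order_open T"
  show "order_open (S \<inter> T)"
    unfolding order_open_def net_catching_for_def
  proof (intro ballI allI impI)
    fix x :: 'a and A :: "'a set" and r and f :: "'a \<Rightarrow> 'a"
    assume x: "x \<in> S \<inter> T" and net: "net_decreasing_to_0 A r f"
    from x net ST obtain a b where ab: "a \<in> A" "b \<in> A"
      "{x - f a .. x + f a} \<subseteq> S" "{x - f b .. x + f b} \<subseteq> T"
      unfolding order_open_def net_catching_for_def by (meson IntD1 IntD2)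
    with net obtain c where c: "c \<in> A" "f c \<le> f a" "f c \<le> f b"
      unfolding net_decreasing_to_0_def directed_index_def by meson
    then have "{x - f c .. x + f c} \<subseteq> {x - f a .. x + f a}"
      "{x - f c .. x + f c} \<subseteq> {x - f b .. x + f b}"
      by (meson add_left_mono atLeastatMost_subset_iff diff_left_mono)+
    with ab c show "\<exists>a\<in>A. {x - f a .. x + f a} \<subseteq> S \<inter> T" by blast
  qed
next
  fix K :: "'a set set"
  assume "\<forall>S\<in>K. order_open S"
  then show "order_open (\<Union>K)"
    unfolding order_open_def net_catching_for_def by (meson UnionE Union_upper subset_trans)
qed

lemma openin_order_topology: "openin order_topology U \<longleftrightarrow> order_open U"
  by (simp add: order_topology_def topology_inverse'[OF istopology_order_open])

section \<open>Linear topologies and the order bound topology\<close>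

definition linear_topology :: "'a::real_vector topology \<Rightarrow> bool" where
  "linear_topology T \<longleftrightarrow>
     topspace T = UNIV \<and>
     continuous_map (prod_topology T T) T (\<lambda>(x, y). x + y) \<and>
     continuous_map (prod_topology euclideanreal T) T (\<lambda>(c, x). c *\<^sub>R x)"

definition circled :: "'a::real_vector set \<Rightarrow> bool" where
  "circled M \<longleftrightarrow> (\<forall>l\<in>{-1..1::real}. (\<lambda>v. l *\<^sub>R v) ` M \<subseteq> M)"

definition absorbs :: "'a::real_vector set \<Rightarrow> 'a set \<Rightarrow> bool" where
  "absorbs M N \<longleftrightarrow> (\<exists>\<mu>>0. \<forall>l\<in>{-\<mu>..\<mu>::real}. (\<lambda>v. l *\<^sub>R v) ` N \<subseteq> M)"

definition order_bound_base :: "'a::ordered_real_vector set set" where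
  "order_bound_base = {V. convex V \<and> circled V \<and> (\<forall>x y. absorbs V {x..y})}"

definition zero_nhd_base :: "'a::real_vector topology \<Rightarrow> 'a set set \<Rightarrow> bool" where
  "zero_nhd_base T B \<longleftrightarrow>
     (\<forall>V\<in>B. \<exists>U. openin T U \<and> 0 \<in> U \<and> U \<subseteq> V) \<and>
     (\<forall>U. openin T U \<and> 0 \<in> U \<longrightarrow> (\<exists>V\<in>B. V \<subseteq> U))"

definition order_bound_topology :: "'a::ordered_real_vector topology" where
  "order_bound_topology = (THE T. linear_topology T \<and> zero_nhd_base T order_bound_base)"

text \<open>
  The remaining lemmas show that this description determines exactly one topology.
\<close>

lemma linear_topology_translation:
  assumes "linear_topology T"
  shows "continuous_map T T (\<lambda>y. c + y)"
proof -
  have top: "topspace T = UNIV"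
    and add: "continuous_map (prod_topology T T) T (\<lambda>(x, y). x + y)"
    using assms unfolding linear_topology_def by blast+
  have "continuous_map T (prod_topology T T) (\<lambda>y. (c, y))"
    unfolding continuous_map_paired by (simp add: top)
  from continuous_map_compose[OF this add] show ?thesis
    unfolding o_def by simp
qed

lemma openin_linear_topology:
  assumes T: "linear_topology T" and B: "zero_nhd_base T B"
  shows "openin T U \<longleftrightarrow> (\<forall>x\<in>U. \<exists>V\<in>B. (\<lambda>v. x + v) ` V \<subseteq> U)"
proof -
  have B1: "\<exists>N. openin T N \<and> 0 \<in> N \<and> N \<subseteq> V" if "V \<in> B" for V
    using B that unfolding zero_nhd_base_def by (elim conjE) (rule bspec)
  have B2: "\<exists>V\<in>B. V \<subseteq> N" if "openin T N" "0 \<in> N" for N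
    using B that unfolding zero_nhd_base_def by (elim conjE) simp
  have pre: "openin T {v. c + v \<in> U}" if "openin T U" for c U
  proof -
    have "topspace T = UNIV" using T unfolding linear_topology_def by blast
    then show ?thesis
      using openin_continuous_map_preimage[OF linear_topology_translation[OF T, of c] that]
      by simp
  qed
  show ?thesis
  proof
    assume U: "openin T U"
    show "\<forall>x\<in>U. \<exists>V\<in>B. (\<lambda>v. x + v) ` V \<subseteq> U"
    proof
      fix x assume "x \<in> U"
      then have "0 \<in> {v. x + v \<in> U}" by simp
      from B2[OF pre[OF U, of x] this]
      obtain V where "V \<in> B" "V \<subseteq> {v. x + v \<in> U}" ..
      then show "\<exists>V\<in>B. (\<lambda>v. x + v) ` V \<subseteq> U" by blast
    qed
  next
    assume R: "\<forall>x\<in>U. \<exists>V\<in>B. (\<lambda>v. x + v) ` V \<subseteq> U"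
    show "openin T U"
    proof (subst openin_subopen, intro ballI)
      fix x assume "x \<in> U"
      then obtain V where V: "V \<in> B" "(\<lambda>v. x + v) ` V \<subseteq> U" using R by blast
      then obtain N where N: "openin T N" "0 \<in> N" "N \<subseteq> V"
        using B1 by blast
      have "{y. - x + y \<in> N} \<subseteq> U"
      proof
        fix y assume "y \<in> {y. - x + y \<in> N}"
        then have "- x + y \<in> V" using N by blast
        then have "x + (- x + y) \<in> U" using V by blast
        then show "y \<in> U" by simp
      qed
      moreover have "x \<in> {y. - x + y \<in> N}" using N(2) by simp
      ultimately show "\<exists>N. openin T N \<and> x \<in> N \<and> N \<subseteq> U"
        using pre[OF N(1), of "- x"] by blast
    qed
  qed
qed

lemma order_bound_baseD:
  assumes "V \<in> order_bound_base"
  shows "convex V" "0 \<in> V" "v \<in> V \<Longrightarrow> \<bar>l\<bar> \<le> 1 \<Longrightarrow> l *\<^sub>R v \<in> V"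
    "\<exists>\<mu>>0. \<forall>l. \<bar>l\<bar> \<le> \<mu> \<longrightarrow> l *\<^sub>R x \<in> V"
proof -
  show "convex V" using assms by (simp add: order_bound_base_def)
  show "l *\<^sub>R v \<in> V" if "v \<in> V" "\<bar>l\<bar> \<le> 1"
    using assms that by (auto simp: order_bound_base_def circled_def image_subset_iff abs_le_iff)
  have *: "\<exists>\<mu>>0. \<forall>l. \<bar>l\<bar> \<le> \<mu> \<longrightarrow> l *\<^sub>R x \<in> V" for x
  proof -
    have "absorbs V {x..x}" using assms unfolding order_bound_base_def by blast
    then obtain \<mu> where "\<mu> > 0" "\<forall>l\<in>{-\<mu>..\<mu>}. l *\<^sub>R x \<in> V" by (auto simp: absorbs_def)
    then show ?thesis by (intro exI[of _ \<mu>]) (auto simp: abs_le_iff)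
  qed
  then show "\<exists>\<mu>>0. \<forall>l. \<bar>l\<bar> \<le> \<mu> \<longrightarrow> l *\<^sub>R x \<in> V" by blast
  show "0 \<in> V" using *[of 0] by (metis abs_zero less_imp_le scaleR_zero_left)
qed

lemma order_bound_base_Int:
  assumes V: "V \<in> order_bound_base" and W: "W \<in> order_bound_base"
  shows "V \<inter> W \<in> order_bound_base"
proof -
  have "absorbs (V \<inter> W) {x..y}" for x y
  proof -
    obtain m n where "m > 0" "\<forall>l\<in>{-m..m}. (\<lambda>v. l *\<^sub>R v) ` {x..y} \<subseteq> V"
      "n > 0" "\<forall>l\<in>{-n..n}. (\<lambda>v. l *\<^sub>R v) ` {x..y} \<subseteq> W"
      using V W unfolding order_bound_base_def absorbs_def by blast
    then show ?thesis unfolding absorbs_def image_subset_iff by (intro exI[of _ "min m n"]) auto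
  qed
  moreover have "circled (V \<inter> W)"
    using V W unfolding order_bound_base_def circled_def by blast
  ultimately show ?thesis
    using V W by (auto simp: order_bound_base_def convex_Int)
qed

lemma order_bound_base_scale:
  assumes V: "V \<in> order_bound_base" and c: "c > 0"
  shows "(\<lambda>v. c *\<^sub>R v) ` V \<in> order_bound_base"
proof -
  have mem: "z \<in> (\<lambda>v. c *\<^sub>R v) ` V \<longleftrightarrow> (1 / c) *\<^sub>R z \<in> V" for z
  proof
    assume "(1 / c) *\<^sub>R z \<in> V"
    moreover have "z = c *\<^sub>R ((1 / c) *\<^sub>R z)" using c by simp
    ultimately show "z \<in> (\<lambda>v. c *\<^sub>R v) ` V" by blast
  qed (use c in auto)
  have "convex ((\<lambda>v. c *\<^sub>R v) ` V)" using V by (simp add: order_bound_base_def convex_scaling)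
  moreover have "circled ((\<lambda>v. c *\<^sub>R v) ` V)"
    unfolding circled_def image_subset_iff[of _ "(\<lambda>v. c *\<^sub>R v) ` V"] mem
  proof (intro ballI)
    fix l :: real and z assume l: "l \<in> {-1..1}" and "z \<in> (\<lambda>v. c *\<^sub>R v) ` V"
    then have "(1 / c) *\<^sub>R z \<in> V" using mem by blast
    moreover have "\<bar>l\<bar> \<le> 1" using l by (auto simp: abs_le_iff)
    ultimately have "l *\<^sub>R ((1 / c) *\<^sub>R z) \<in> V"
      by (rule order_bound_baseD(3)[OF V])
    then show "(1 / c) *\<^sub>R (l *\<^sub>R z) \<in> V" by (simp add: mult.commute)
  qed
  moreover have "absorbs ((\<lambda>v. c *\<^sub>R v) ` V) {x..y}" for x y
  proof -
    have "absorbs V {x..y}" using V by (simp add: order_bound_base_def)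
    then obtain m where m: "m > 0" "\<And>l z. \<lbrakk>\<bar>l\<bar> \<le> m; z \<in> {x..y}\<rbrakk> \<Longrightarrow> l *\<^sub>R z \<in> V"
      unfolding absorbs_def image_subset_iff by (auto simp: abs_le_iff)
    have "(1 / c) *\<^sub>R (l *\<^sub>R z) \<in> V" if "l \<in> {-(c * m)..c * m}" "z \<in> {x..y}" for l z
    proof -
      have "\<bar>l\<bar> \<le> c * m" using that by (auto simp: abs_le_iff)
      then have "\<bar>l / c\<bar> \<le> m" using c by (simp add: abs_divide field_simps)
      from m(2)[OF this that(2)] show ?thesis by simp
    qed
    then show ?thesis
      unfolding absorbs_def image_subset_iff mem
      using c m(1) by (intro exI[of _ "c * m"]) auto
  qed
  ultimately show ?thesis by (simp add: order_bound_base_def)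
qed

lemma order_bound_base_halves:
  assumes V: "V \<in> order_bound_base"
    and "v \<in> (\<lambda>v. (1/2) *\<^sub>R v) ` V" "w \<in> (\<lambda>v. (1/2) *\<^sub>R v) ` V"
  shows "v + w \<in> V"
proof -
  obtain a b where ab: "a \<in> V" "b \<in> V" "v = (1/2) *\<^sub>R a" "w = (1/2) *\<^sub>R b" using assms by blast
  have "(1/2) *\<^sub>R a + (1/2) *\<^sub>R b \<in> V"
    by (rule convexD[OF order_bound_baseD(1)[OF V] ab(1,2)]) auto
  with ab show ?thesis by simp
qed

lemma order_bound_topology_exists:
  "\<exists>T :: 'a::ordered_real_vector topology. linear_topology T \<and> zero_nhd_base T order_bound_base"
proof -
  let ?B = "order_bound_base :: 'a set set"
  define P where "P U \<longleftrightarrow> (\<forall>x\<in>U. \<exists>V\<in>?B. \<forall>v\<in>V. x + v \<in> U)" for U :: "'a set"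
  have U0: "(UNIV :: 'a set) \<in> ?B"
    by (auto simp: order_bound_base_def circled_def absorbs_def intro: exI[of _ 1])
  have half: "(\<lambda>v. (1/2) *\<^sub>R v) ` V \<in> ?B" if "V \<in> ?B" for V
    using order_bound_base_scale[OF that, of "1/2"] by simp
  have PI: "P (S \<inter> T)" if ST: "P S" "P T" for S T
    unfolding P_def
  proof
    fix x assume x: "x \<in> S \<inter> T"
    obtain V where V: "V \<in> ?B" "\<forall>v\<in>V. x + v \<in> S" using x ST(1) unfolding P_def by blast
    obtain W where W: "W \<in> ?B" "\<forall>v\<in>W. x + v \<in> T" using x ST(2) unfolding P_def by blast
    show "\<exists>V\<in>?B. \<forall>v\<in>V. x + v \<in> S \<inter> T"
      by (rule bexI[OF _ order_bound_base_Int[OF V(1) W(1)]]) (use V(2) W(2) in blast)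
  qed
  have PU: "P (\<Union>K)" if "\<forall>S\<in>K. P S" for K
    using that unfolding P_def by (meson UnionE UnionI)
  have ist: "istopology P" unfolding istopology_def using PI PU by blast
  define T where "T = topology P"
  have op: "openin T U \<longleftrightarrow> P U" for U
    by (simp add: T_def topology_inverse'[OF ist])
  have "P UNIV" unfolding P_def using U0 by blast
  then have top: "topspace T = UNIV" using op openin_subset by blast
  have open_nhd: "\<exists>V\<in>?B. \<forall>v\<in>V. x + v \<in> U" if "openin T U" "x \<in> U" for U x
    using that unfolding op P_def by (rule bspec)
  have nhd: "\<exists>U. openin T U \<and> x \<in> U \<and> (\<forall>u\<in>U. u - x \<in> V)" if V: "V \<in> ?B" for x V
  proof -
    define U where "U = {y. \<exists>W\<in>?B. \<forall>w\<in>W. y + w - x \<in> V}"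
    have "P U" unfolding P_def
    proof
      fix y assume "y \<in> U"
      then obtain W where W: "W \<in> ?B" "\<forall>w\<in>W. y + w - x \<in> V" unfolding U_def by blast
      have "y + z \<in> U" if z: "z \<in> (\<lambda>v. (1/2) *\<^sub>R v) ` W" for z
      proof -
        have "y + z + w - x \<in> V" if w: "w \<in> (\<lambda>v. (1/2) *\<^sub>R v) ` W" for w
          using W(2)[rule_format, OF order_bound_base_halves[OF W(1) z w]] by (simp add: add.assoc)
        then show ?thesis unfolding U_def using half[OF W(1)] by blast
      qed
      then show "\<exists>V\<in>?B. \<forall>v\<in>V. y + v \<in> U" using half[OF W(1)] by blast
    qed
    moreover have "x \<in> U" unfolding U_def using V by (auto intro!: bexI[of _ V])
    moreover have "u - x \<in> V" if "u \<in> U" for u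
    proof -
      obtain W where W: "W \<in> ?B" "\<forall>w\<in>W. u + w - x \<in> V" using \<open>u \<in> U\<close> unfolding U_def by blast
      from W(2)[rule_format, OF order_bound_baseD(2)[OF W(1)]] show ?thesis by simp
    qed
    ultimately show ?thesis using op by blast
  qed
  have base: "zero_nhd_base T ?B"
    unfolding zero_nhd_base_def
  proof (intro conjI ballI allI impI)
    fix V assume "V \<in> ?B"
    from nhd[OF this, of 0] show "\<exists>U. openin T U \<and> 0 \<in> U \<and> U \<subseteq> V"
      unfolding diff_zero by blast
  next
    fix U assume "openin T U \<and> 0 \<in> U"
    then have "\<exists>V\<in>?B. \<forall>v\<in>V. 0 + v \<in> U" using open_nhd by blast
    then show "\<exists>V\<in>?B. V \<subseteq> U" unfolding add_0 by blast
  qed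
  have add: "continuous_map (prod_topology T T) T (\<lambda>(x, y). x + y)"
    unfolding continuous_map_def
  proof (intro conjI allI impI)
    fix U assume U: "openin T U"
    have "\<exists>M N. openin T M \<and> openin T N \<and> x \<in> M \<and> y \<in> N \<and> M \<times> N \<subseteq> {p. fst p + snd p \<in> U}"
      if xy: "x + y \<in> U" for x y
    proof -
      obtain V where V: "V \<in> ?B" "\<forall>v\<in>V. x + y + v \<in> U" using open_nhd[OF U xy] by blast
      obtain M where M: "openin T M" "x \<in> M" "\<forall>m\<in>M. m - x \<in> (\<lambda>v. (1/2) *\<^sub>R v) ` V"
        using nhd[OF half[OF V(1)], of x] by blast
      obtain N where N: "openin T N" "y \<in> N" "\<forall>n\<in>N. n - y \<in> (\<lambda>v. (1/2) *\<^sub>R v) ` V"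
        using nhd[OF half[OF V(1)], of y] by blast
      have "m + n \<in> U" if m: "m \<in> M" and n: "n \<in> N" for m n
      proof -
        have "x + y + ((m - x) + (n - y)) \<in> U"
          using V(2)[rule_format, OF order_bound_base_halves[OF V(1) bspec[OF M(3) m] bspec[OF N(3) n]]] .
        moreover have "x + y + ((m - x) + (n - y)) = m + n" by (simp add: algebra_simps)
        ultimately show ?thesis by (simp only:)
      qed
      then have "M \<times> N \<subseteq> {p. fst p + snd p \<in> U}" by auto
      with M(1,2) N(1,2) show ?thesis by blast
    qed
    then have "openin (prod_topology T T) {p. fst p + snd p \<in> U}"
      unfolding openin_prod_topology_alt by simp
    then show "openin (prod_topology T T) {p \<in> topspace (prod_topology T T). (case p of (x, y) \<Rightarrow> x + y) \<in> U}"
      by (simp add: top case_prod_beta)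
  qed (simp add: top)
  have scale: "continuous_map (prod_topology euclideanreal T) T (\<lambda>(c, x). c *\<^sub>R x)"
    unfolding continuous_map_def
  proof (intro conjI allI impI)
    fix U assume U: "openin T U"
    have "\<exists>M N. openin euclideanreal M \<and> openin T N \<and> c \<in> M \<and> x \<in> N \<and> M \<times> N \<subseteq> {p. fst p *\<^sub>R snd p \<in> U}"
      if cx: "c *\<^sub>R x \<in> U" for c x
    proof -
      obtain V where V: "V \<in> ?B" "\<forall>v\<in>V. c *\<^sub>R x + v \<in> U" using open_nhd[OF U cx] by blast
      define H where "H = (\<lambda>v. (1/2) *\<^sub>R v) ` V"
      have HB: "H \<in> ?B" unfolding H_def by (rule half[OF V(1)])
      obtain \<mu> where \<mu>: "\<mu> > 0" "\<forall>l. \<bar>l\<bar> \<le> \<mu> \<longrightarrow> l *\<^sub>R x \<in> H"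
        using order_bound_baseD(4)[OF HB, of x] by blast
      define k where "k = \<bar>c\<bar> + \<mu>"
      have k: "k > 0" using \<mu>(1) by (simp add: k_def)
      then have WB: "(\<lambda>v. (1/k) *\<^sub>R v) ` H \<in> ?B" by (intro order_bound_base_scale[OF HB]) simp
      obtain N where N: "openin T N" "x \<in> N" "\<forall>n\<in>N. n - x \<in> (\<lambda>v. (1/k) *\<^sub>R v) ` H"
        using nhd[OF WB, of x] by blast
      have "d *\<^sub>R n \<in> U" if d: "d \<in> ball c \<mu>" and n: "n \<in> N" for d n
      proof -
        have dc: "\<bar>d - c\<bar> \<le> \<mu>" using d by (simp add: dist_real_def)
        then have "\<bar>d\<bar> \<le> k" unfolding k_def by linarith
        then have dk: "\<bar>d / k\<bar> \<le> 1" using k by (simp add: abs_divide)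
        obtain h where h: "h \<in> H" "n - x = (1/k) *\<^sub>R h" using bspec[OF N(3) n] by blast
        have "(d - c) *\<^sub>R x \<in> H" using \<mu>(2) dc by blast
        moreover have "(d / k) *\<^sub>R h \<in> H" by (rule order_bound_baseD(3)[OF HB h(1) dk])
        ultimately have "(d - c) *\<^sub>R x + (d / k) *\<^sub>R h \<in> V"
          unfolding H_def by (rule order_bound_base_halves[OF V(1)])
        then have "c *\<^sub>R x + ((d - c) *\<^sub>R x + (d / k) *\<^sub>R h) \<in> U" using V(2) by blast
        moreover have "(d / k) *\<^sub>R h = d *\<^sub>R (n - x)" by (simp add: h(2))
        then have "c *\<^sub>R x + ((d - c) *\<^sub>R x + (d / k) *\<^sub>R h) = d *\<^sub>R n"
          by (simp add: scaleR_left_diff_distrib scaleR_right_diff_distrib)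
        ultimately show ?thesis by (simp only:)
      qed
      then have "ball c \<mu> \<times> N \<subseteq> {p. fst p *\<^sub>R snd p \<in> U}" by auto
      moreover have "openin euclideanreal (ball c \<mu>)" "c \<in> ball c \<mu>" using \<mu>(1) by simp_all
      ultimately show ?thesis using N(1,2) by blast
    qed
    then have "openin (prod_topology euclideanreal T) {p. fst p *\<^sub>R snd p \<in> U}"
      unfolding openin_prod_topology_alt by simp
    then show "openin (prod_topology euclideanreal T)
        {p \<in> topspace (prod_topology euclideanreal T). (case p of (c, x) \<Rightarrow> c *\<^sub>R x) \<in> U}"
      by (simp add: top case_prod_beta)
  qed (simp add: top)
  have "linear_topology T"
    unfolding linear_topology_def by (intro conjI top add scale)
  with base show ?thesis by blast
qed

lemma order_bound_topology_ex1:
  "\<exists>!T :: 'a::ordered_real_vector topology. linear_topology T \<and> zero_nhd_base T order_bound_base"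
proof (rule ex_ex1I[OF order_bound_topology_exists])
  fix S T :: "'a topology"
  assume S: "linear_topology S \<and> zero_nhd_base S order_bound_base"
    and T: "linear_topology T \<and> zero_nhd_base T order_bound_base"
  show "S = T"
    unfolding topology_eq
    by (simp add: openin_linear_topology[OF conjunct1[OF S] conjunct2[OF S]]
        openin_linear_topology[OF conjunct1[OF T] conjunct2[OF T]])
qed

lemma order_bound_topology_linear: "linear_topology order_bound_topology"
  and order_bound_topology_base: "zero_nhd_base order_bound_topology order_bound_base"
  using theI'[OF order_bound_topology_ex1] unfolding order_bound_topology_def by blast+

end

theory Submission
  imports Defs
begin

text \<open>
  The set of differences of positive elements is order open and the positive cone is order closed.
  If the order topology is linear, the first is a neighbourhood of zero, hence absorbing, so that
  the space is directed; and \<open>n x \<le> w\<close> for all \<open>n\<close> puts \<open>- x = lim (w / n - x)\<close> into the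
  closed cone, so that the space is Archimedean.
  Conversely, in an Archimedean directed space \<open>v / n\<close> decreases to zero for every \<open>v \<ge> 0\<close>. A net
  catching element \<open>u\<close> therefore dominates some \<open>v / n\<close>, which makes it an order unit, and both
  the order topology and the order bound topology have the intervals \<open>{- e u..e u}\<close> as
  a base at zero.
\<close>

section \<open>Nets decreasing to zero and what net catching elements do with them\<close>

lemma net_decreasing_to_0_scaleR:
  fixes f :: "'i \<Rightarrow> 'a::ordered_real_vector"
  assumes f: "net_decreasing_to_0 A r f" and c: "c > 0"
  shows "net_decreasing_to_0 A r (\<lambda>a. c *\<^sub>R f a)"
proof -
  have "z \<le> 0" if "\<forall>a\<in>A. z \<le> c *\<^sub>R f a" for z
  proof -
    have "(1 / c) *\<^sub>R z \<le> f a" if "a \<in> A" for a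
      using scaleR_left_mono[of z "c *\<^sub>R f a" "1 / c"] \<open>\<forall>a\<in>A. z \<le> c *\<^sub>R f a\<close> that c by simp
    then have "(1 / c) *\<^sub>R z \<le> 0"
      using f unfolding net_decreasing_to_0_def by blast
    from scaleR_left_mono[OF this, of c] show ?thesis using c by simp
  qed
  then show ?thesis
    using f c unfolding net_decreasing_to_0_def by (auto intro!: scaleR_left_mono scaleR_nonneg_nonneg)
qed

text \<open>A lower bound \<open>z\<close> of all these multiples satisfies \<open>n z <= v\<close>
  for every \<open>n\<close>, which is exactly the premise of the Archimedean property. Indexing by
  \<open>Suc n\<close> keeps the scalars positive.\<close>

lemma net_decreasing_to_0_inverse_Suc:
  fixes v :: "'a::ordered_real_vector"
  assumes arch: "archimedean_space TYPE('a)" and v: "0 \<le> v"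
  shows "net_decreasing_to_0 UNIV {(m, n). m \<le> n} (\<lambda>n. (1 / real (Suc n)) *\<^sub>R v)"
proof -
  have "directed_index UNIV {(m, n :: nat). m \<le> n}"
    unfolding directed_index_def preorder_on_def refl_on_def trans_def
    by (auto intro: max.cobounded1 max.cobounded2)
  moreover have "(1 / real (Suc n)) *\<^sub>R v \<le> (1 / real (Suc m)) *\<^sub>R v" if "m \<le> n" for m n
    using that v by (intro scaleR_right_mono) (auto simp: frac_le)
  moreover have "z \<le> 0" if z: "\<forall>n. z \<le> (1 / real (Suc n)) *\<^sub>R v" for z
  proof -
    have "real n *\<^sub>R z \<le> v" for n
    proof (cases n)
      case (Suc m)
      have "real (Suc m) *\<^sub>R z \<le> real (Suc m) *\<^sub>R ((1 / real (Suc m)) *\<^sub>R v)"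
        using z by (intro scaleR_left_mono) auto
      also have "\<dots> = v"
        by (simp del: of_nat_Suc)
      finally show ?thesis using Suc by simp
    qed (use v in simp)
    then show ?thesis using arch unfolding archimedean_space_def by blast
  qed
  ultimately show ?thesis
    using v unfolding net_decreasing_to_0_def by (auto intro!: scaleR_nonneg_nonneg)
qed

lemma net_catching_element_nonneg:
  fixes u :: "'a::ordered_real_vector"
  assumes "net_catching_element u"
  shows "0 \<le> u"
proof -
  \<comment> \<open>The constant net 0 on a one-point index set can only be caught by an element
    above 0.\<close>
  have "net_decreasing_to_0 {()} {((), ())} (\<lambda>_. 0 :: 'a)"
    by (auto simp: net_decreasing_to_0_def directed_index_def preorder_on_def refl_on_def trans_def)
  from net_catching_element_any_index[OF assms this] show ?thesis by simp
qed

section \<open>From a linear order topology to a directed Archimedean space\<close>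

text \<open>The map \<open>c \<mapsto> b + c w\<close> is continuous at 0 and
  \<open>1 / Suc n\<close> tends to 0. With \<open>b = 0\<close> this makes open neighbourhoods of 0
  reach a positive multiple of every vector; with \<open>b = - x\<close> it yields the limit
  argument for the Archimedean property.\<close>

lemma linear_topology_inverse_Suc_in_open:
  assumes T: "linear_topology T" and U: "openin T U" "b \<in> U"
  shows "\<exists>n. (1 / real (Suc n)) *\<^sub>R w + b \<in> U"
proof -
  have top: "topspace T = UNIV"
    and sc: "continuous_map (prod_topology euclideanreal T) T (\<lambda>(c, x). c *\<^sub>R x)"
    using T unfolding linear_topology_def by blast+
  have "continuous_map euclideanreal (prod_topology euclideanreal T) (\<lambda>c. (c, w))"
    unfolding continuous_map_paired by (simp add: top)
  from continuous_map_compose[OF this sc]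
  have "continuous_map euclideanreal T (\<lambda>c. c *\<^sub>R w)" by (simp add: o_def)
  from continuous_map_compose[OF this linear_topology_translation[OF T, of b]]
  have "continuous_map euclideanreal T (\<lambda>c. b + c *\<^sub>R w)" by (simp add: o_def)
  from openin_continuous_map_preimage[OF this U(1)]
  have "open {c. b + c *\<^sub>R w \<in> U}" by simp
  moreover have "0 \<in> {c. b + c *\<^sub>R w \<in> U}" using U(2) by simp
  ultimately obtain e where e: "e > 0" "ball 0 e \<subseteq> {c. b + c *\<^sub>R w \<in> U}"
    by (meson openE)
  obtain n where "1 / real (Suc n) < e"
    using reals_Archimedean[OF e(1)] by (auto simp: inverse_eq_divide)
  then have "1 / real (Suc n) \<in> ball 0 e" by simp
  with e(2) have "b + (1 / real (Suc n)) *\<^sub>R w \<in> U" by blast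
  then show ?thesis by (subst add.commute) (rule exI)
qed

lemma linear_order_topology_imp_directed:
  assumes lin: "linear_topology (order_topology :: 'a::ordered_real_vector topology)"
  shows "directed_space TYPE('a)"
proof -
  \<comment> \<open>This is the set of differences of positive elements, since
    \<open>x = z - (z - x)\<close>.\<close>
  define D where "D = {x :: 'a. \<exists>z\<ge>0. x \<le> z}"
  have "order_open D"
    unfolding order_open_def net_catching_for_def
  proof (intro ballI allI impI)
    fix x :: 'a and A :: "'a set" and r and f :: "'a \<Rightarrow> 'a"
    assume "x \<in> D" and f: "net_decreasing_to_0 A r f"
    then obtain z where z: "0 \<le> z" "x \<le> z" unfolding D_def by blast
    from f obtain a where a: "a \<in> A" "0 \<le> f a"
      unfolding net_decreasing_to_0_def directed_index_def by blast
    have "{x - f a .. x + f a} \<subseteq> D"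
    proof
      fix t assume "t \<in> {x - f a .. x + f a}"
      then have "t \<le> x + f a" by simp
      also have "\<dots> \<le> z + f a" using z by simp
      finally show "t \<in> D" unfolding D_def using z a by (auto intro: add_nonneg_nonneg)
    qed
    with a show "\<exists>a\<in>A. {x - f a .. x + f a} \<subseteq> D" by blast
  qed
  then have D: "openin order_topology D" by (simp add: openin_order_topology)
  have "0 \<in> D" unfolding D_def by blast
  \<comment> \<open>A small positive multiple of \<open>x\<close> lies in the open set
    \<open>D\<close>, and \<open>D\<close> is stable under scaling back up, so \<open>D\<close> is
    the whole space.\<close>
  have pos: "\<exists>z\<ge>0. x \<le> z" for x :: 'a
  proof -
    obtain n z where nz: "0 \<le> z" "(1 / real (Suc n)) *\<^sub>R x \<le> z"
      using linear_topology_inverse_Suc_in_open[OF lin D \<open>0 \<in> D\<close>, of x] unfolding D_def by auto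
    have "x = real (Suc n) *\<^sub>R ((1 / real (Suc n)) *\<^sub>R x)" by (simp del: of_nat_Suc)
    also have "\<dots> \<le> real (Suc n) *\<^sub>R z" using nz by (intro scaleR_left_mono) auto
    finally show ?thesis using nz(1) by (meson scaleR_nonneg_nonneg of_nat_0_le_iff)
  qed
  have "\<exists>z. x \<le> z \<and> y \<le> z" for x y :: 'a
  proof -
    obtain z where "0 \<le> z" "x - y \<le> z" using pos by blast
    then show ?thesis by (intro exI[of _ "z + y"]) (simp add: diff_le_eq)
  qed
  then show ?thesis unfolding directed_space_def by blast
qed

text \<open>If every interval of the net around \<open>x\<close> met the positive cone, then
  \<open>0 <= x + f a\<close> for all \<open>a\<close>; so \<open>- x\<close> would be a lower bound
  of the net, whence \<open>- x <= 0\<close>.\<close>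

lemma order_open_not_nonneg: "order_open {x :: 'a::ordered_real_vector. \<not> 0 \<le> x}"
  unfolding order_open_def net_catching_for_def
proof (intro ballI allI impI, rule ccontr)
  fix x :: 'a and A :: "'a set" and r and f :: "'a \<Rightarrow> 'a"
  assume x: "x \<in> {x. \<not> 0 \<le> x}" and f: "net_decreasing_to_0 A r f"
    and "\<not> (\<exists>a\<in>A. {x - f a .. x + f a} \<subseteq> {x. \<not> 0 \<le> x})"
  then have "\<exists>t\<ge>0. t \<le> x + f a" if "a \<in> A" for a using that by fastforce
  then have "0 \<le> x + f a" if "a \<in> A" for a using that order_trans by blast
  then have "\<forall>a\<in>A. - x \<le> f a" by (metis add.inverse_inverse diff_ge_0_iff_ge diff_minus_eq_add add.commute)
  then have "- x \<le> 0" using f unfolding net_decreasing_to_0_def by blast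
  with x show False by simp
qed

lemma linear_order_topology_imp_archimedean:
  assumes lin: "linear_topology (order_topology :: 'a::ordered_real_vector topology)"
  shows "archimedean_space TYPE('a)"
  unfolding archimedean_space_def
proof (intro allI impI, rule ccontr)
  fix x w :: 'a
  assume le: "\<forall>n::nat. real n *\<^sub>R x \<le> w" and "\<not> x \<le> 0"
  \<comment> \<open>The points \<open>w / Suc n - x\<close> all lie in the cone, yet their limit
    \<open>- x\<close> lies in its open complement.\<close>
  then have "- x \<in> {x. \<not> 0 \<le> x}" by simp
  then obtain n where "\<not> 0 \<le> (1 / real (Suc n)) *\<^sub>R w + - x"
    using linear_topology_inverse_Suc_in_open[OF lin] order_open_not_nonneg openin_order_topology by blast
  moreover have "x \<le> (1 / real (Suc n)) *\<^sub>R w"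
    using scaleR_left_mono[OF le[rule_format, of "Suc n"], of "1 / real (Suc n)"]
    by (simp del: of_nat_Suc)
  ultimately show False by simp
qed

section \<open>Order units and interval neighbourhoods in both topologies\<close>

lemma net_catching_element_imp_order_unit:
  fixes u :: "'a::ordered_real_vector"
  assumes arch: "archimedean_space TYPE('a)" and dir: "directed_space TYPE('a)"
    and u: "net_catching_element u"
  shows "order_unit u"
proof -
  have "\<exists>n::nat. x \<le> real n *\<^sub>R u" for x
  proof -
    \<comment> \<open>A common upper bound of 0 and \<open>x\<close> replaces \<open>x\<close>,
      because the multiples \<open>v / Suc n\<close> decrease only for a positive
      \<open>v\<close>.\<close>
    obtain v where v: "0 \<le> v" "x \<le> v" using dir unfolding directed_space_def by blast
    obtain n where n: "(1 / real (Suc n)) *\<^sub>R v \<le> u"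
      using net_catching_element_any_index[OF u net_decreasing_to_0_inverse_Suc[OF arch v(1)]] by blast
    have "x \<le> real (Suc n) *\<^sub>R ((1 / real (Suc n)) *\<^sub>R v)" using v by (simp del: of_nat_Suc)
    also have "\<dots> \<le> real (Suc n) *\<^sub>R u" using n by (intro scaleR_left_mono) auto
    finally show ?thesis by blast
  qed
  then show ?thesis unfolding order_unit_def using net_catching_element_nonneg[OF u] by blast
qed

text \<open>An order open set must catch the particular net \<open>u / Suc n\<close>, which gives
  the intervals. Conversely, any net \<open>f\<close> divided by \<open>e\<close> still decreases to
  0, so \<open>u\<close> dominates some \<open>f a / e\<close>, and \<open>f a <= e u\<close> fits
  the net interval into the given one.\<close>

lemma order_open_iff_interval:
  fixes u :: "'a::ordered_real_vector"
  assumes arch: "archimedean_space TYPE('a)" and u: "net_catching_element u"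
  shows "order_open U \<longleftrightarrow> (\<forall>x\<in>U. \<exists>e>0. {x - e *\<^sub>R u .. x + e *\<^sub>R u} \<subseteq> U)"
proof
  assume U: "order_open U"
  show "\<forall>x\<in>U. \<exists>e>0. {x - e *\<^sub>R u .. x + e *\<^sub>R u} \<subseteq> U"
  proof
    fix x assume "x \<in> U"
    then have "net_catching_for U x" using U unfolding order_open_def by blast
    from net_catching_for_any_index[OF this
        net_decreasing_to_0_inverse_Suc[OF arch net_catching_element_nonneg[OF u]]]
    obtain n where "{x - (1 / real (Suc n)) *\<^sub>R u .. x + (1 / real (Suc n)) *\<^sub>R u} \<subseteq> U" by blast
    then show "\<exists>e>0. {x - e *\<^sub>R u .. x + e *\<^sub>R u} \<subseteq> U"
      by (intro exI[of _ "1 / real (Suc n)"]) simp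
  qed
next
  assume R: "\<forall>x\<in>U. \<exists>e>0. {x - e *\<^sub>R u .. x + e *\<^sub>R u} \<subseteq> U"
  show "order_open U"
    unfolding order_open_def net_catching_for_def
  proof (intro ballI allI impI)
    fix x :: 'a and A :: "'a set" and r and f :: "'a \<Rightarrow> 'a"
    assume x: "x \<in> U" and f: "net_decreasing_to_0 A r f"
    obtain e where e: "e > 0" "{x - e *\<^sub>R u .. x + e *\<^sub>R u} \<subseteq> U" using R x by blast
    then obtain a where a: "a \<in> A" "(1 / e) *\<^sub>R f a \<le> u"
      using net_catching_element_any_index[OF u net_decreasing_to_0_scaleR[OF f, of "1 / e"]] by auto
    then have "f a \<le> e *\<^sub>R u"
      using scaleR_left_mono[OF a(2), of e] e(1) by simp
    then have "{x - f a .. x + f a} \<subseteq> {x - e *\<^sub>R u .. x + e *\<^sub>R u}"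
      by (simp add: atLeastatMost_subset_iff diff_left_mono)
    with a(1) e(2) show "\<exists>a\<in>A. {x - f a .. x + f a} \<subseteq> U" by blast
  qed
qed

lemma scaleR_mem_symmetric_interval:
  fixes u z :: "'a::ordered_real_vector"
  assumes z: "- (l *\<^sub>R u) \<le> z" "z \<le> l *\<^sub>R u"
  shows "- ((\<bar>c\<bar> * l) *\<^sub>R u) \<le> c *\<^sub>R z \<and> c *\<^sub>R z \<le> (\<bar>c\<bar> * l) *\<^sub>R u"
proof -
  have z': "- z \<le> l *\<^sub>R u" using z(1) by (simp add: minus_le_iff)
  have 1: "\<bar>c\<bar> *\<^sub>R z \<le> (\<bar>c\<bar> * l) *\<^sub>R u" "- (\<bar>c\<bar> *\<^sub>R z) \<le> (\<bar>c\<bar> * l) *\<^sub>R u"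
    using scaleR_left_mono[OF z(2), of "\<bar>c\<bar>"] scaleR_left_mono[OF z', of "\<bar>c\<bar>"] by simp_all
  show ?thesis
  \<comment> \<open>For negative \<open>c\<close>, \<open>c z = - (\<bar>c\<bar> z)\<close>, so the
    two bounds exchange roles.\<close>
  proof (cases "c \<ge> 0")
    case True
    with 1 show ?thesis by (simp add: minus_le_iff)
  next
    case False
    with 1 show ?thesis by (simp add: minus_le_iff)
  qed
qed

lemma order_unit_interval:
  fixes u z :: "'a::ordered_real_vector"
  assumes "order_unit u"
  shows "\<exists>l>0. - (l *\<^sub>R u) \<le> z \<and> z \<le> l *\<^sub>R u"
proof -
  obtain m n :: nat where mn: "z \<le> real m *\<^sub>R u" "- z \<le> real n *\<^sub>R u" and u: "0 \<le> u"
    using assms unfolding order_unit_def by blast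
  \<comment> \<open>The summand 1 keeps \<open>l\<close> positive even when \<open>m\<close> and
    \<open>n\<close> are both 0.\<close>
  define l where "l = real m + real n + 1"
  have "real m *\<^sub>R u \<le> l *\<^sub>R u" "real n *\<^sub>R u \<le> l *\<^sub>R u"
    using u by (auto simp: l_def intro!: scaleR_right_mono)
  with mn have "z \<le> l *\<^sub>R u" "- z \<le> l *\<^sub>R u" by auto
  then show ?thesis by (intro exI[of _ l]) (auto simp: l_def minus_le_iff)
qed

lemma symmetric_interval_in_order_bound_base:
  fixes u :: "'a::ordered_real_vector"
  assumes u: "order_unit u" and e: "e > 0"
  shows "{- (e *\<^sub>R u) .. e *\<^sub>R u} \<in> order_bound_base"
proof -
  have u0: "0 \<le> u" using u by (simp add: order_unit_def)
  \<comment> \<open>This serves twice: \<open>l = e\<close> gives circledness, and an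
    \<open>l\<close> bounding a whole order interval gives absorption.\<close>
  have mem: "c *\<^sub>R z \<in> {- (e *\<^sub>R u) .. e *\<^sub>R u}"
    if z: "- (l *\<^sub>R u) \<le> z" "z \<le> l *\<^sub>R u" and c: "\<bar>c\<bar> * l \<le> e" for c l z
  proof -
    have "(\<bar>c\<bar> * l) *\<^sub>R u \<le> e *\<^sub>R u" using c u0 by (rule scaleR_right_mono)
    then show ?thesis
      using scaleR_mem_symmetric_interval[OF z, of c] by (meson atLeastAtMost_iff neg_le_iff_le order_trans)
  qed
  have "convex {- (e *\<^sub>R u) .. e *\<^sub>R u}"
  proof (rule convexI)
    fix x y :: 'a and s t :: real
    assume xy: "x \<in> {- (e *\<^sub>R u) .. e *\<^sub>R u}" "y \<in> {- (e *\<^sub>R u) .. e *\<^sub>R u}"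
      and st: "0 \<le> s" "0 \<le> t" "s + t = 1"
    have "s *\<^sub>R (- (e *\<^sub>R u)) + t *\<^sub>R (- (e *\<^sub>R u)) \<le> s *\<^sub>R x + t *\<^sub>R y"
      "s *\<^sub>R x + t *\<^sub>R y \<le> s *\<^sub>R (e *\<^sub>R u) + t *\<^sub>R (e *\<^sub>R u)"
      using xy st by (intro add_mono scaleR_left_mono; simp)+
    then show "s *\<^sub>R x + t *\<^sub>R y \<in> {- (e *\<^sub>R u) .. e *\<^sub>R u}"
      using st(3) by (simp only: scaleR_left_distrib[symmetric] atLeastAtMost_iff scaleR_one)
  qed
  moreover have "circled {- (e *\<^sub>R u) .. e *\<^sub>R u}"
    unfolding circled_def image_subset_iff
  proof (intro ballI)
    fix l :: real and z assume "l \<in> {-1..1}" "z \<in> {- (e *\<^sub>R u) .. e *\<^sub>R u}"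
    moreover from this have "\<bar>l\<bar> * e \<le> e" using e by (simp add: abs_le_iff)
    ultimately show "l *\<^sub>R z \<in> {- (e *\<^sub>R u) .. e *\<^sub>R u}" by (intro mem[of e]) auto
  qed
  moreover have "absorbs {- (e *\<^sub>R u) .. e *\<^sub>R u} {x..y}" for x y
  proof -
    obtain k where k: "k > 0" "- (k *\<^sub>R u) \<le> x" using order_unit_interval[OF u] by blast
    obtain m where m: "m > 0" "y \<le> m *\<^sub>R u" using order_unit_interval[OF u] by blast
    \<comment> \<open>One radius for both endpoints: \<open>[x, y]\<close> lies in
      \<open>[- l u, l u]\<close>, hence is absorbed with constant \<open>e / l\<close>.\<close>
    define l where "l = k + m"
    have l: "l > 0" "k *\<^sub>R u \<le> l *\<^sub>R u" "m *\<^sub>R u \<le> l *\<^sub>R u"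
      using k(1) m(1) u0 by (auto simp: l_def intro!: scaleR_right_mono)
    then have kx: "- (l *\<^sub>R u) \<le> x" "y \<le> l *\<^sub>R u"
      using k(2) m(2) by (meson neg_le_iff_le order_trans)+
    show ?thesis
      unfolding absorbs_def image_subset_iff
    proof (intro exI[of _ "e / l"] conjI ballI)
      show "e / l > 0" using e l by simp
      fix c z assume c: "c \<in> {- (e / l)..e / l}" and z: "z \<in> {x..y}"
      have "\<bar>c\<bar> \<le> e / l" using c by (auto simp: abs_le_iff)
      then have "\<bar>c\<bar> * l \<le> e" using l by (simp add: field_simps)
      with z kx show "c *\<^sub>R z \<in> {- (e *\<^sub>R u) .. e *\<^sub>R u}"
        by (intro mem[of l]) (auto intro: order_trans)
    qed
  qed
  ultimately show ?thesis by (simp add: order_bound_base_def)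
qed

text \<open>Each base set absorbs \<open>[- u, u]\<close> and so contains some
  \<open>[- e u, e u]\<close>, while these intervals are base sets themselves. The criterion
  coincides with the one for order open sets, which is how the two topologies get
  identified.\<close>

lemma openin_order_bound_topology_iff_interval:
  fixes u :: "'a::ordered_real_vector"
  assumes u: "order_unit u"
  shows "openin order_bound_topology U \<longleftrightarrow> (\<forall>x\<in>U. \<exists>e>0. {x - e *\<^sub>R u .. x + e *\<^sub>R u} \<subseteq> U)"
proof -
  have u0: "0 \<le> u" using u by (simp add: order_unit_def)
  have tr: "(\<lambda>v. x + v) ` {- (e *\<^sub>R u) .. e *\<^sub>R u} = {x - e *\<^sub>R u .. x + e *\<^sub>R u}" for x and e :: real
  proof -
    have "t \<in> (\<lambda>v. x + v) ` {- (e *\<^sub>R u) .. e *\<^sub>R u}" if "t \<in> {x - e *\<^sub>R u .. x + e *\<^sub>R u}" for t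
      using that by (intro image_eqI[of _ _ "t - x"]) (auto simp: algebra_simps)
    moreover have "x - e *\<^sub>R u \<le> x + v" if "- (e *\<^sub>R u) \<le> v" for v
      using add_left_mono[OF that, of x] by simp
    ultimately show ?thesis by auto
  qed
  have "(\<exists>V\<in>order_bound_base. (\<lambda>v. x + v) ` V \<subseteq> U) \<longleftrightarrow>
      (\<exists>e>0. {x - e *\<^sub>R u .. x + e *\<^sub>R u} \<subseteq> U)" for x
  proof
    assume "\<exists>V\<in>order_bound_base. (\<lambda>v. x + v) ` V \<subseteq> U"
    then obtain V where V: "V \<in> order_bound_base" "(\<lambda>v. x + v) ` V \<subseteq> U" by blast
    then have "absorbs V {- u .. u}" unfolding order_bound_base_def by blast
    then obtain e where e: "e > 0" "(\<lambda>v. e *\<^sub>R v) ` {- u .. u} \<subseteq> V"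
      unfolding absorbs_def by fastforce
    have "{- (e *\<^sub>R u) .. e *\<^sub>R u} \<subseteq> V"
    proof
      fix z assume z: "z \<in> {- (e *\<^sub>R u) .. e *\<^sub>R u}"
      have "(1 / e) *\<^sub>R z \<in> {- u .. u}"
        using scaleR_mem_symmetric_interval[of e u z "1 / e"] z e(1) by simp
      then have "e *\<^sub>R ((1 / e) *\<^sub>R z) \<in> V" using e(2) by blast
      then show "z \<in> V" using e(1) by simp
    qed
    then have "(\<lambda>v. x + v) ` {- (e *\<^sub>R u) .. e *\<^sub>R u} \<subseteq> U" using V(2) by blast
    then show "\<exists>e>0. {x - e *\<^sub>R u .. x + e *\<^sub>R u} \<subseteq> U" unfolding tr using e(1) by blast
  next
    assume "\<exists>e>0. {x - e *\<^sub>R u .. x + e *\<^sub>R u} \<subseteq> U"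
    then show "\<exists>V\<in>order_bound_base. (\<lambda>v. x + v) ` V \<subseteq> U"
      using symmetric_interval_in_order_bound_base[OF u] tr by metis
  qed
  then show ?thesis
    by (simp add: openin_linear_topology[OF order_bound_topology_linear order_bound_topology_base])
qed

section \<open>The order unit norm and the topology it generates\<close>

lemma order_unit_norm_nonneg:
  fixes u :: "'a::ordered_real_vector"
  assumes "order_unit u"
  shows "0 \<le> order_unit_norm u z"
  unfolding order_unit_norm_def using order_unit_interval[OF assms, of z]
  by (intro cInf_greatest) auto

text \<open>The Archimedean property turns \<open>z <= (l + e) u\<close> for all
  \<open>e > 0\<close> into \<open>z <= l u\<close>, so the bounds survive the passage to the
  infimum. This includes \<open>l = 0\<close>, which gives definiteness of the norm.\<close>

lemma order_unit_norm_le_iff: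
  fixes u :: "'a::ordered_real_vector"
  assumes arch: "archimedean_space TYPE('a)" and u: "order_unit u" and l: "0 \<le> l"
  shows "order_unit_norm u z \<le> l \<longleftrightarrow> - (l *\<^sub>R u) \<le> z \<and> z \<le> l *\<^sub>R u"
proof -
  let ?N = "{k. 0 < k \<and> - (k *\<^sub>R u) \<le> z \<and> z \<le> k *\<^sub>R u}"
  have u0: "0 \<le> u" using u by (simp add: order_unit_def)
  have mono: "k *\<^sub>R u \<le> m *\<^sub>R u" if "k \<le> m" for k m :: real
    using that u0 by (rule scaleR_right_mono)
  have ne: "?N \<noteq> {}" using order_unit_interval[OF u, of z] by blast
  have bdd: "bdd_below ?N" by (rule bdd_belowI[of _ 0]) simp
  have limit: "w \<le> l *\<^sub>R u" if w: "\<And>e. e > 0 \<Longrightarrow> w \<le> (l + e) *\<^sub>R u" for w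
  proof -
    have "real n *\<^sub>R (w - l *\<^sub>R u) \<le> u" for n
    proof (cases n)
      case (Suc m)
      have "w - l *\<^sub>R u \<le> (1 / real (Suc m)) *\<^sub>R u"
        using w[of "1 / real (Suc m)"] by (simp add: diff_le_eq scaleR_left_distrib add.commute)
      from scaleR_left_mono[OF this, of "real (Suc m)"] show ?thesis
        using Suc by (simp del: of_nat_Suc)
    qed (use u0 in simp)
    then have "w - l *\<^sub>R u \<le> 0" using arch unfolding archimedean_space_def by blast
    then show ?thesis by simp
  qed
  show ?thesis
  proof
    assume "order_unit_norm u z \<le> l"
    then have "Inf ?N \<le> l" by (simp add: order_unit_norm_def)
    have "z \<le> (l + e) *\<^sub>R u \<and> - z \<le> (l + e) *\<^sub>R u" if "e > 0" for e
    proof -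
      have "Inf ?N < l + e" using \<open>Inf ?N \<le> l\<close> that by simp
      then obtain k where k: "k \<in> ?N" "k < l + e" using cInf_lessD[OF ne] by blast
      then have "z \<le> k *\<^sub>R u" "- z \<le> k *\<^sub>R u" by (auto simp: minus_le_iff)
      with mono[of k "l + e"] k(2) show ?thesis by auto
    qed
    then have "z \<le> l *\<^sub>R u" "- z \<le> l *\<^sub>R u" using limit by blast+
    then show "- (l *\<^sub>R u) \<le> z \<and> z \<le> l *\<^sub>R u" by (simp add: minus_le_iff)
  next
    assume z: "- (l *\<^sub>R u) \<le> z \<and> z \<le> l *\<^sub>R u"
    show "order_unit_norm u z \<le> l"
      unfolding order_unit_norm_def
    \<comment> \<open>For \<open>l = 0\<close> the number \<open>l\<close> is not a member of the
      set, which holds positive numbers only; \<open>l + e\<close> always is.\<close>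
    proof (rule field_le_epsilon)
      fix e :: real assume e: "e > 0"
      have "l *\<^sub>R u \<le> (l + e) *\<^sub>R u" using e by (intro mono) simp
      with z have "- ((l + e) *\<^sub>R u) \<le> z \<and> z \<le> (l + e) *\<^sub>R u"
        by (meson neg_le_iff_le order_trans)
      then show "Inf ?N \<le> l + e" using l e by (intro cInf_lower bdd) auto
    qed
  qed
qed

lemma is_norm_order_unit_norm:
  fixes u :: "'a::ordered_real_vector"
  assumes arch: "archimedean_space TYPE('a)" and u: "order_unit u"
  shows "is_norm (order_unit_norm u)"
proof -
  let ?p = "order_unit_norm u"
  note nn = order_unit_norm_nonneg[OF u]
  note le = order_unit_norm_le_iff[OF arch u]
  have bounds: "- (?p x *\<^sub>R u) \<le> x" "x \<le> ?p x *\<^sub>R u" for x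
    using le[of "?p x" x] nn by auto
  have zero: "?p x = 0 \<longleftrightarrow> x = 0" for x
    using le[of 0 x] nn[of x] by auto
  have tri: "?p (x + y) \<le> ?p x + ?p y" for x y
  proof -
    have "- (?p x *\<^sub>R u) + - (?p y *\<^sub>R u) \<le> x + y" "x + y \<le> ?p x *\<^sub>R u + ?p y *\<^sub>R u"
      by (intro add_mono bounds)+
    then show ?thesis using nn by (simp add: le scaleR_left_distrib)
  qed
  have hom_le: "?p (c *\<^sub>R x) \<le> \<bar>c\<bar> * ?p x" for c x
    using scaleR_mem_symmetric_interval[OF bounds[of x], of c] nn by (simp add: le)
  have hom: "?p (c *\<^sub>R x) = \<bar>c\<bar> * ?p x" for c x
  proof (cases "c = 0")
    case True
    then show ?thesis by (simp add: zero)
  next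
    case False
    \<comment> \<open>The reverse inequality comes from undoing the scaling by
      \<open>c\<close>.\<close>
    then have "?p x \<le> \<bar>1 / c\<bar> * ?p (c *\<^sub>R x)" using hom_le[of "1 / c" "c *\<^sub>R x"] by simp
    then have "\<bar>c\<bar> * ?p x \<le> ?p (c *\<^sub>R x)" using False by (simp add: field_simps)
    with hom_le[of c x] show ?thesis by simp
  qed
  show ?thesis unfolding is_norm_def using nn zero tri hom by blast
qed

lemma Metric_space_is_norm:
  assumes "is_norm p"
  shows "Metric_space UNIV (\<lambda>x y. p (x - y))"
proof
  have p: "\<And>x. 0 \<le> p x" "\<And>x. p x = 0 \<longleftrightarrow> x = 0" "\<And>x y. p (x + y) \<le> p x + p y"
    "\<And>c x. p (c *\<^sub>R x) = \<bar>c\<bar> * p x"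
    using assms unfolding is_norm_def by blast+
  fix x y z
  show "0 \<le> p (x - y)" by (rule p)
  show "p (x - y) = p (y - x)" using p(4)[of "-1" "x - y"] by simp
  show "p (x - y) = 0 \<longleftrightarrow> x = y" by (simp add: p(2))
  show "p (x - z) \<le> p (x - y) + p (y - z)" using p(3)[of "x - y" "y - z"] by simp
qed

text \<open>The closed balls of the norm are exactly the intervals
  \<open>[x - e u, x + e u]\<close>, so metric openness becomes the interval criterion for order
  openness.\<close>

lemma norm_generates_order_topology:
  fixes u :: "'a::ordered_real_vector"
  assumes arch: "archimedean_space TYPE('a)" and ou: "order_unit u" and u: "net_catching_element u"
  shows "norm_generates (order_unit_norm u) order_topology"
proof -
  let ?p = "order_unit_norm u"
  have nrm: "is_norm ?p" by (rule is_norm_order_unit_norm[OF arch ou])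
  interpret Metric_space UNIV "\<lambda>x y. ?p (x - y)" by (rule Metric_space_is_norm[OF nrm])
  have interval: "{x - e *\<^sub>R u .. x + e *\<^sub>R u} = {y. ?p (x - y) \<le> e}" if "e > 0" for x e
    using that by (auto simp: order_unit_norm_le_iff[OF arch ou] algebra_simps)
  have "(\<exists>r>0. mball x r \<subseteq> U) \<longleftrightarrow> (\<exists>e>0. {x - e *\<^sub>R u .. x + e *\<^sub>R u} \<subseteq> U)" for x U
  proof
    assume "\<exists>r>0. mball x r \<subseteq> U"
    then obtain r where r: "r > 0" "mball x r \<subseteq> U" by blast
    \<comment> \<open>Halving the radius puts a closed ball inside the open one.\<close>
    then have "{x - (r / 2) *\<^sub>R u .. x + (r / 2) *\<^sub>R u} \<subseteq> U"
      by (subst interval) (auto simp: subset_iff in_mball)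
    then show "\<exists>e>0. {x - e *\<^sub>R u .. x + e *\<^sub>R u} \<subseteq> U" using r(1) half_gt_zero by blast
  next
    assume "\<exists>e>0. {x - e *\<^sub>R u .. x + e *\<^sub>R u} \<subseteq> U"
    then obtain e where e: "e > 0" "{y. ?p (x - y) \<le> e} \<subseteq> U" using interval by metis
    then have "mball x e \<subseteq> U" by (auto simp: in_mball)
    then show "\<exists>r>0. mball x r \<subseteq> U" using e(1) by blast
  qed
  then have "mtopology = order_topology"
    unfolding topology_eq openin_mtopology openin_order_topology order_open_iff_interval[OF arch u]
    by blast
  then show ?thesis unfolding norm_generates_def using nrm by blast
qed

theorem theorem8p2:
  assumes "\<exists>y :: 'a::ordered_real_vector. net_catching_element y"
  shows "(linear_topology (order_topology :: 'a topology)
            \<longleftrightarrow> (order_topology :: 'a topology) = order_bound_topology) \<and>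
         ((order_topology :: 'a topology) = order_bound_topology
            \<longleftrightarrow> archimedean_space TYPE('a) \<and> directed_space TYPE('a)) \<and>
         (linear_topology (order_topology :: 'a topology) \<or>
          (order_topology :: 'a topology) = order_bound_topology \<or>
          (archimedean_space TYPE('a) \<and> directed_space TYPE('a))
            \<longrightarrow> (\<forall>x :: 'a. net_catching_element x
                  \<longrightarrow> order_unit x \<and> norm_generates (order_unit_norm x) order_topology))"
proof -
  obtain u :: 'a where u: "net_catching_element u" using assms by blast
  let ?AD = "archimedean_space TYPE('a) \<and> directed_space TYPE('a)"
  have lin: ?AD if "linear_topology (order_topology :: 'a topology)"
    using linear_order_topology_imp_archimedean linear_order_topology_imp_directed that by blast
  have eq: "(order_topology :: 'a topology) = order_bound_topology" if ?AD
    unfolding topology_eq openin_order_topology order_open_iff_interval[OF conjunct1[OF that] u]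
      openin_order_bound_topology_iff_interval
        [OF net_catching_element_imp_order_unit[OF conjunct1[OF that] conjunct2[OF that] u]]
    by blast
  have "order_unit x \<and> norm_generates (order_unit_norm x) order_topology"
    if ?AD "net_catching_element x" for x :: 'a
    using that net_catching_element_imp_order_unit norm_generates_order_topology by blast
  \<comment> \<open>The cycle closes because the order bound topology is linear: equality with it
    makes the order topology linear.\<close>
  then show ?thesis
    using lin eq order_bound_topology_linear by metis
qed

end
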